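(* Fix integers $n,k\geq 1$ and $l\geq 0$ such that $n+l\geq 2$. Then the group $\mathcal{K}'_{n,k,l}$ is not finitely generated. In fact, $H_1(\mathcal{K}'_{n,k,l};\mathbb{Q})$ has infinite rank.
   Context: $F_{n,k,l}$ is the free group on the $n+k+l$ letters $X\cup Y\cup Z$, where $X=\{x_1,\ldots,x_n\}$, $Y=\{y_1,\ldots,y_k\}$, $Z=\{z_1,\ldots,z_l\}$. Define $$\mathcal{A}'_{n,k,l}=\{f\in\mathrm{Aut}(F_{n,k,l})\mid f(v)=v\text{ for all }v\in Y\cup Z\}.$$ Let $N$ be the normal closure of $Y$ in $F_{n,k,l}$, and identify $F_{n,k,l}/N$ with $F_{n,0,l}$ (the free group on $X\cup Z$). Every $f\in\mathcal{A}'_{n,k,l}$ preserves $N$, so there is an induced homomorphism $\rho'\colon\mathcal{A}'_{n,k,l}\to\mathcal{A}'_{n,0,l}$, which is a split surjection. Define $\mathcal{K}'_{n,k,l}=\ker(\rho')$. *)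

theory Defs
  imports
    "HOL-Algebra.Bij"
    "HOL-Algebra.Generated_Groups"
    "HOL-Algebra.AbelCoset"
    "HOL-Library.Poly_Mapping"
    "Jordan_Normal_Form.VS_Connect"
begin

section \<open>Free groups\<close>

text \<open>
  The free group on a set is realised by reduced words. A signed letter is a pair
  \<open>(a, e)\<close>, standing for \<open>a\<close> if \<open>e\<close> is true and for the formal inverse of \<open>a\<close> otherwise.
\<close>

fun inv_letter :: "'a \<times> bool \<Rightarrow> 'a \<times> bool" where
  "inv_letter (a, e) = (a, \<not> e)"

definition reduced :: "('a \<times> bool) list \<Rightarrow> bool" where
  "reduced w \<longleftrightarrow> successively (\<lambda>p q. q \<noteq> inv_letter p) w"

fun cons_red :: "'a \<times> bool \<Rightarrow> ('a \<times> bool) list \<Rightarrow> ('a \<times> bool) list" where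
  "cons_red p [] = [p]"
| "cons_red p (q # w) = (if q = inv_letter p then w else p # q # w)"

definition free_group :: "'a set \<Rightarrow> ('a \<times> bool) list monoid" where
  "free_group S =
     \<lparr>carrier = {w. reduced w \<and> fst ` set w \<subseteq> S},
      mult = (\<lambda>u v. foldr cons_red u v),
      one = []\<rparr>"

definition gen :: "'a \<Rightarrow> ('a \<times> bool) list" where
  "gen a = [(a, True)]"

definition normal_closure :: "('a, 'm) monoid_scheme \<Rightarrow> 'a set \<Rightarrow> 'a set" where
  "normal_closure G S = \<Inter> {N. N \<lhd> G \<and> S \<subseteq> N}"

definition finitely_generated :: "('a, 'm) monoid_scheme \<Rightarrow> bool" where
  "finitely_generated G \<longleftrightarrow>
     (\<exists>S. finite S \<and> S \<subseteq> carrier G \<and> generate G S = carrier G)"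

lemma inv_letter_simps [simp]:
  "inv_letter (inv_letter p) = p" "inv_letter p \<noteq> p" "p \<noteq> inv_letter p"
  "fst (inv_letter p) = fst p" "p = inv_letter q \<longleftrightarrow> inv_letter p = q"
  by (cases p; cases q; auto)+

lemma reduced_Nil [simp]: "reduced []"
  by (simp add: reduced_def)

lemma reduced_Cons: "reduced (p # w) \<longleftrightarrow> (w = [] \<or> hd w \<noteq> inv_letter p) \<and> reduced w"
  by (auto simp: reduced_def successively_Cons)

lemma reduced_cons_red: "reduced w \<Longrightarrow> reduced (cons_red p w)"
  by (cases w) (auto simp: reduced_Cons)

lemma cons_red_cancel: "reduced w \<Longrightarrow> cons_red p (cons_red (inv_letter p) w) = w"
  by (cases w; cases "tl w") (auto simp: reduced_Cons)

lemma cons_red_cancel': "reduced w \<Longrightarrow> cons_red (inv_letter p) (cons_red p w) = w"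
  using cons_red_cancel[of w "inv_letter p"] by simp

lemma cons_red_reduced: "reduced (p # w) \<Longrightarrow> cons_red p w = p # w"
  by (cases w) (auto simp: reduced_Cons)

lemma letters_cons_red: "fst ` set (cons_red p w) \<subseteq> insert (fst p) (fst ` set w)"
  by (cases w) auto

lemma reduced_foldr: "reduced v \<Longrightarrow> reduced (foldr cons_red u v)"
  by (induction u) (auto intro: reduced_cons_red)

lemma letters_foldr: "fst ` set (foldr cons_red u v) \<subseteq> fst ` set u \<union> fst ` set v"
proof (induction u)
  case (Cons p u)
  then show ?case
    using letters_cons_red[of p "foldr cons_red u v"] by simp blast
qed simp

lemma foldr_cons_red:
  "reduced v \<Longrightarrow> foldr cons_red (cons_red p u) v = cons_red p (foldr cons_red u v)"
  using cons_red_cancel[of "foldr cons_red (tl u) v" p]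
  by (cases u) (auto simp: reduced_foldr simp del: inv_letter.simps)

lemma foldr_assoc:
  "reduced w \<Longrightarrow> foldr cons_red (foldr cons_red u v) w = foldr cons_red u (foldr cons_red v w)"
  by (induction u) (auto simp: foldr_cons_red)

lemma foldr_Nil: "reduced w \<Longrightarrow> foldr cons_red w [] = w"
  by (induction w) (auto simp: reduced_Cons cons_red_reduced)

lemma foldr_inverse:
  "reduced v \<Longrightarrow> foldr cons_red (rev (map inv_letter w)) (foldr cons_red w v) = v"
  by (induction w) (auto simp: cons_red_cancel' reduced_foldr)

theorem group_free_group: "group (free_group S)"
proof (rule groupI)
  fix x y z assume "x \<in> carrier (free_group S)" "y \<in> carrier (free_group S)"
  then show "x \<otimes>\<^bsub>free_group S\<^esub> y \<in> carrier (free_group S)"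
    using letters_foldr[of x y] by (simp add: free_group_def reduced_foldr) blast
next
  fix x assume x: "x \<in> carrier (free_group S)"
  let ?y = "foldr cons_red (rev (map inv_letter x)) []"
  have "?y \<in> carrier (free_group S)"
    using x letters_foldr[of "rev (map inv_letter x)" "[]"]
    by (auto simp: free_group_def reduced_foldr image_image)
  moreover have "?y \<otimes>\<^bsub>free_group S\<^esub> x = \<one>\<^bsub>free_group S\<^esub>"
    using x foldr_inverse[of "[]" x] by (simp add: free_group_def foldr_assoc foldr_Nil)
  ultimately show "\<exists>y\<in>carrier (free_group S). y \<otimes>\<^bsub>free_group S\<^esub> x = \<one>\<^bsub>free_group S\<^esub>"
    by blast
qed (auto simp: free_group_def foldr_assoc)

lemma (in group) normal_closure_normal:
  assumes "S \<subseteq> carrier G"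
  shows "normal_closure G S \<lhd> G" "S \<subseteq> normal_closure G S"
proof -
  have "carrier G \<lhd> G"
    by (simp add: normal_inv_iff subgroup_self)
  then have ne: "{N. N \<lhd> G \<and> S \<subseteq> N} \<noteq> {}"
    using assms by blast
  have "subgroup (\<Inter> {N. N \<lhd> G \<and> S \<subseteq> N}) G"
    by (rule subgroups_Inter) (use ne in \<open>auto simp: normal_inv_iff\<close>)
  then show "normal_closure G S \<lhd> G"
    unfolding normal_closure_def normal_inv_iff by (auto simp: normal_inv_iff)
  show "S \<subseteq> normal_closure G S"
    by (auto simp: normal_closure_def)
qed


section \<open>The groups of automorphisms\<close>

datatype letter = Xv nat | Yv nat | Zv nat

definition Xs :: "nat \<Rightarrow> letter set" where "Xs n = Xv ` {1..n}"
definition Ys :: "nat \<Rightarrow> letter set" where "Ys k = Yv ` {1..k}"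
definition Zs :: "nat \<Rightarrow> letter set" where "Zs l = Zv ` {1..l}"

type_synonym word = "(letter \<times> bool) list"

definition F :: "nat \<Rightarrow> nat \<Rightarrow> nat \<Rightarrow> word monoid" where
  "F n k l = free_group (Xs n \<union> Ys k \<union> Zs l)"

definition A' :: "nat \<Rightarrow> nat \<Rightarrow> nat \<Rightarrow> (word \<Rightarrow> word) monoid" where
  "A' n k l = (AutoGroup (F n k l))
     \<lparr>carrier := {f \<in> auto (F n k l). \<forall>v \<in> Ys k \<union> Zs l. f (gen v) = gen v}\<rparr>"

definition NY :: "nat \<Rightarrow> nat \<Rightarrow> nat \<Rightarrow> word set" where
  "NY n k l = normal_closure (F n k l) (gen ` Ys k)"

text \<open>
  The identification of \<open>F n 0 l\<close> with \<open>F n k l Mod NY n k l\<close> sends a word to its coset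
  (words in \<open>X \<union> Z\<close> are among the words in \<open>X \<union> Y \<union> Z\<close>); see \<open>ident_iso\<close> below.
\<close>

definition ident :: "nat \<Rightarrow> nat \<Rightarrow> nat \<Rightarrow> word \<Rightarrow> word set" where
  "ident n k l w = NY n k l #>\<^bsub>F n k l\<^esub> w"

lemma group_F: "group (F n k l)"
  by (simp add: F_def group_free_group)

lemma carrier_F:
  "w \<in> carrier (F n k l) \<longleftrightarrow> reduced w \<and> fst ` set w \<subseteq> Xs n \<union> Ys k \<union> Zs l"
  by (simp add: F_def free_group_def)

lemma mult_F: "u \<otimes>\<^bsub>F n k l\<^esub> v = foldr cons_red u v"
  by (simp add: F_def free_group_def)

lemma one_F: "\<one>\<^bsub>F n k l\<^esub> = []"
  by (simp add: F_def free_group_def)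

lemma Ys_0 [simp]: "Ys 0 = {}"
  by (simp add: Ys_def)

lemma Ys_disjoint: "a \<in> Ys k \<Longrightarrow> a \<notin> Xs n \<and> a \<notin> Zs l"
  by (auto simp: Xs_def Ys_def Zs_def)

definition del_Y :: "nat \<Rightarrow> word \<Rightarrow> word" where
  "del_Y k w = foldr cons_red (filter (\<lambda>p. fst p \<notin> Ys k) w) []"

lemma reduced_del_Y: "reduced (del_Y k w)"
  by (simp add: del_Y_def reduced_foldr)

lemma del_Y_cons_red:
  "del_Y k (cons_red p w) = (if fst p \<in> Ys k then del_Y k w else cons_red p (del_Y k w))"
proof (cases w)
  case (Cons q w')
  then show ?thesis
    using cons_red_cancel[of "del_Y k w'" p] reduced_del_Y[of k w']
    by (auto simp: del_Y_def)
qed (auto simp: del_Y_def)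

lemma del_Y_mult: "del_Y k (foldr cons_red u v) = foldr cons_red (del_Y k u) (del_Y k v)"
proof -
  have "del_Y k (foldr cons_red u v)
      = foldr cons_red (filter (\<lambda>p. fst p \<notin> Ys k) u) (del_Y k v)"
    by (induction u) (auto simp: del_Y_cons_red)
  also have "\<dots> = foldr cons_red (del_Y k u) (del_Y k v)"
    unfolding del_Y_def[of k u] by (simp add: foldr_assoc reduced_del_Y)
  finally show ?thesis .
qed

lemma del_Y_closed:
  assumes "w \<in> carrier (F n k l)"
  shows "del_Y k w \<in> carrier (F n 0 l)"
proof -
  have "fst ` set (filter (\<lambda>p. fst p \<notin> Ys k) w) \<subseteq> Xs n \<union> Zs l"
    using assms by (auto simp: carrier_F)
  then have "fst ` set (del_Y k w) \<subseteq> Xs n \<union> Zs l"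
    using letters_foldr[of "filter (\<lambda>p. fst p \<notin> Ys k) w" "[]"] unfolding del_Y_def by simp
  then show ?thesis
    by (simp add: carrier_F reduced_del_Y)
qed

lemma del_Y_hom: "del_Y k \<in> hom (F n k l) (F n 0 l)"
  by (auto simp: hom_def del_Y_closed mult_F del_Y_mult)

lemma del_Y_id:
  assumes "w \<in> carrier (F n 0 l)"
  shows "del_Y k w = w"
proof -
  have "filter (\<lambda>p. fst p \<notin> Ys k) w = w"
    using assms Ys_disjoint by (force simp: carrier_F filter_id_conv)
  then show ?thesis
    using assms by (simp add: del_Y_def foldr_Nil carrier_F)
qed

lemma gen_Ys_closed: "gen ` Ys k \<subseteq> carrier (F n k l)"
  by (auto simp: carrier_F gen_def reduced_Cons)

lemma NY_normal: "NY n k l \<lhd> F n k l" and gen_Ys_NY: "gen ` Ys k \<subseteq> NY n k l"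
  using group.normal_closure_normal[OF group_F gen_Ys_closed] by (auto simp: NY_def)

lemma del_Y_NY:
  assumes "w \<in> NY n k l"
  shows "del_Y k w = []"
proof -
  interpret group_hom "F n k l" "F n 0 l" "del_Y k"
    by (simp add: group_hom_def group_hom_axioms_def group_F del_Y_hom)
  have "gen ` Ys k \<subseteq> kernel (F n k l) (F n 0 l) (del_Y k)"
    using gen_Ys_closed[of k n l] by (auto simp: kernel_def one_F del_Y_def gen_def)
  then have "NY n k l \<subseteq> kernel (F n k l) (F n 0 l) (del_Y k)"
    unfolding NY_def normal_closure_def using normal_kernel by blast
  then show ?thesis
    using assms by (auto simp: kernel_def one_F)
qed

lemma ident_del_Y:
  assumes "w \<in> carrier (F n k l)"
  shows "ident n k l w = ident n k l (del_Y k w)"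
proof -
  interpret N: normal "NY n k l" "F n k l"
    by (rule NY_normal)
  let ?F = "F n k l"
  have *: "fst ` set u \<subseteq> Xs n \<union> Ys k \<union> Zs l \<Longrightarrow>
      ident n k l (foldr cons_red u []) =
      ident n k l (foldr cons_red (filter (\<lambda>p. fst p \<notin> Ys k) u) [])" for u
  proof (induction u)
    case (Cons p u)
    let ?x = "foldr cons_red u []"
    let ?y = "foldr cons_red (filter (\<lambda>p. fst p \<notin> Ys k) u) []"
    have x: "?x \<in> carrier ?F"
      using Cons.prems letters_foldr[of u "[]"] by (auto simp: carrier_F reduced_foldr)
    have y: "?y \<in> carrier ?F"
      using Cons.prems letters_foldr[of "filter (\<lambda>p. fst p \<notin> Ys k) u" "[]"]
      by (auto simp: carrier_F reduced_foldr)
    have p: "[p] \<in> carrier ?F"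
      using Cons.prems by (auto simp: carrier_F reduced_Cons)
    have IH: "ident n k l ?x = ident n k l ?y"
      using Cons by simp
    have split: "ident n k l (cons_red p v) = ident n k l [p] <#>\<^bsub>?F\<^esub> ident n k l v"
      if "v \<in> carrier ?F" for v
      using N.rcos_sum[OF p that] by (simp add: ident_def mult_F)
    show ?case
    proof (cases "fst p \<in> Ys k")
      case True
      have "[p] \<in> NY n k l"
      proof (cases "snd p")
        case True
        with \<open>fst p \<in> Ys k\<close> show ?thesis
          using gen_Ys_NY[of k n l] by (cases p) (auto simp: gen_def)
      next
        case False
        have g: "[inv_letter p] \<in> NY n k l"
          using \<open>fst p \<in> Ys k\<close> False gen_Ys_NY[of k n l] by (cases p) (auto simp: gen_def)
        have "[p] = inv\<^bsub>?F\<^esub> [inv_letter p]"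
          by (rule N.inv_equality[symmetric])
            (use p N.mem_carrier[OF g] in \<open>auto simp: mult_F one_F\<close>)
        then show ?thesis
          using g by (simp add: N.m_inv_closed)
      qed
      then have "ident n k l [p] = NY n k l"
        by (simp add: ident_def N.rcos_const)
      then have "ident n k l (cons_red p ?x) = ident n k l ?x"
        using split[OF x] x N.rcosets_mult_eq[of "ident n k l ?x"]
        by (auto simp: ident_def RCOSETS_def)
      then show ?thesis
        using True IH by simp
    next
      case False
      then show ?thesis
        using split[OF x] split[OF y] IH by simp
    qed
  qed simp
  show ?thesis
    using *[of w] assms by (simp add: carrier_F foldr_Nil del_Y_def)
qed

theorem ident_iso: "ident n k l \<in> iso (F n 0 l) (F n k l Mod NY n k l)"
proof -
  interpret N: normal "NY n k l" "F n k l"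
    by (rule NY_normal)
  have sub: "carrier (F n 0 l) \<subseteq> carrier (F n k l)"
    by (auto simp: carrier_F subset_iff)
  have "ident n k l \<in> hom (F n 0 l) (F n k l Mod NY n k l)"
  proof (rule homI)
    fix u v assume uv: "u \<in> carrier (F n 0 l)" "v \<in> carrier (F n 0 l)"
    with sub show "ident n k l u \<in> carrier (F n k l Mod NY n k l)"
      by (auto simp: FactGroup_def ident_def RCOSETS_def)
    from uv sub N.rcos_sum[of u v]
    show "ident n k l (u \<otimes>\<^bsub>F n 0 l\<^esub> v) =
        ident n k l u \<otimes>\<^bsub>F n k l Mod NY n k l\<^esub> ident n k l v"
      by (auto simp: FactGroup_def ident_def mult_F subset_iff)
  qed
  moreover have "inj_on (ident n k l) (carrier (F n 0 l))"
  proof (rule inj_onI)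
    fix u v
    assume u: "u \<in> carrier (F n 0 l)" and v: "v \<in> carrier (F n 0 l)"
      and eq: "ident n k l u = ident n k l v"
    have "u \<in> ident n k l v"
      using eq N.rcos_self[of u] u sub N.subgroup_axioms by (auto simp: ident_def)
    then obtain m where m: "m \<in> NY n k l" "u = foldr cons_red m v"
      by (auto simp: ident_def r_coset_def mult_F)
    have "del_Y k u = del_Y k v"
      by (simp add: m(2) del_Y_mult del_Y_NY[OF m(1)])
    then show "u = v"
      using u v by (simp add: del_Y_id)
  qed
  moreover have "carrier (F n k l Mod NY n k l) \<subseteq> ident n k l ` carrier (F n 0 l)"
  proof
    fix C assume "C \<in> carrier (F n k l Mod NY n k l)"
    then obtain w where "w \<in> carrier (F n k l)" "C = ident n k l w"
      by (auto simp: FactGroup_def RCOSETS_def ident_def)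
    then show "C \<in> ident n k l ` carrier (F n 0 l)"
      using ident_del_Y del_Y_closed by blast
  qed
  ultimately show ?thesis
    by (auto simp: iso_def bij_betw_def hom_def)
qed

text \<open>
  An automorphism \<open>f\<close> acts on cosets by taking images; this action is transported along
  \<open>ident\<close>. The restriction matches the convention of \<^const>\<open>AutoGroup\<close>, whose elements are
  extensional functions.
\<close>

definition rho' :: "nat \<Rightarrow> nat \<Rightarrow> nat \<Rightarrow> (word \<Rightarrow> word) \<Rightarrow> (word \<Rightarrow> word)" where
  "rho' n k l f =
     (\<lambda>w \<in> carrier (F n 0 l). inv_into (carrier (F n 0 l)) (ident n k l) (f ` ident n k l w))"

definition K' :: "nat \<Rightarrow> nat \<Rightarrow> nat \<Rightarrow> (word \<Rightarrow> word) monoid" where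
  "K' n k l = (A' n k l) \<lparr>carrier := kernel (A' n k l) (A' n 0 l) (rho' n k l)\<rparr>"


section \<open>Group homology with rational coefficients\<close>

text \<open>
  Homology of the inhomogeneous bar complex with trivial coefficients: the list
  \<open>[g\<^sub>1, \<dots>, g\<^sub>n]\<close> is the bar generator \<open>[g\<^sub>1 | \<dots> | g\<^sub>n]\<close>, and its boundary is
  \<open>[g\<^sub>2 | \<dots> | g\<^sub>n] + (\<Sum>0<i<n. (-1)^i [g\<^sub>1 | \<dots> | g\<^sub>i g\<^sub>i\<^sub>+\<^sub>1 | \<dots> | g\<^sub>n]) + (-1)^n [g\<^sub>1 | \<dots> | g\<^sub>n\<^sub>-\<^sub>1]\<close>.
\<close>

type_synonym 'g chain = "'g list \<Rightarrow>\<^sub>0 rat"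

definition bar_face :: "('g, 'm) monoid_scheme \<Rightarrow> nat \<Rightarrow> 'g list \<Rightarrow> 'g list" where
  "bar_face G i gs =
     (if i = 0 then tl gs
      else if i = length gs then butlast gs
      else take (i - 1) gs @ [gs ! (i - 1) \<otimes>\<^bsub>G\<^esub> gs ! i] @ drop (i + 1) gs)"

definition bar_d :: "('g, 'm) monoid_scheme \<Rightarrow> 'g list \<Rightarrow> 'g chain" where
  "bar_d G gs =
     (if gs = [] then 0
      else (\<Sum>i\<le>length gs. Poly_Mapping.single (bar_face G i gs) ((-1) ^ i)))"

definition chain_smult :: "rat \<Rightarrow> 'g chain \<Rightarrow> 'g chain" where
  "chain_smult q c = Poly_Mapping.map ((*) q) c"

definition bar_boundary :: "('g, 'm) monoid_scheme \<Rightarrow> 'g chain \<Rightarrow> 'g chain" where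
  "bar_boundary G c =
     (\<Sum>gs\<in>Poly_Mapping.keys c. chain_smult (Poly_Mapping.lookup c gs) (bar_d G gs))"

definition bar_chains :: "('g, 'm) monoid_scheme \<Rightarrow> nat \<Rightarrow> 'g chain set" where
  "bar_chains G n = {c. \<forall>gs \<in> Poly_Mapping.keys c. length gs = n \<and> set gs \<subseteq> carrier G}"

definition bar_cycles :: "('g, 'm) monoid_scheme \<Rightarrow> nat \<Rightarrow> 'g chain set" where
  "bar_cycles G n = {c \<in> bar_chains G n. bar_boundary G c = 0}"

definition bar_boundaries :: "('g, 'm) monoid_scheme \<Rightarrow> nat \<Rightarrow> 'g chain set" where
  "bar_boundaries G n = bar_boundary G ` bar_chains G (Suc n)"

text \<open>
  The fields \<open>mult\<close> and \<open>one\<close> of a module record carry no meaning.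
\<close>

definition cycle_module :: "('g, 'm) monoid_scheme \<Rightarrow> nat \<Rightarrow> (rat, 'g chain) module" where
  "cycle_module G n =
     \<lparr>carrier = bar_cycles G n, mult = (\<lambda>_ _. 0), one = 0,
      zero = 0, add = (+), smult = chain_smult\<rparr>"

definition quotient_module ::
    "('r, 'a, 'm) module_scheme \<Rightarrow> 'a set \<Rightarrow> ('r, 'a set) module" where
  "quotient_module M B =
     \<lparr>carrier = a_rcosets\<^bsub>M\<^esub> B, mult = (\<lambda>_ _. B), one = B,
      zero = B, add = set_add M, smult = (\<lambda>r C. set_add M B ((\<lambda>x. r \<odot>\<^bsub>M\<^esub> x) ` C))\<rparr>"

definition rat_homology ::
    "nat \<Rightarrow> ('g, 'm) monoid_scheme \<Rightarrow> (rat, 'g chain set) module" where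
  "rat_homology n G = quotient_module (cycle_module G n) (bar_boundaries G n)"

abbreviation rat_field :: "rat ring" where
  "rat_field \<equiv> class_ring"

lemma lookup_chain_smult [simp]:
  "Poly_Mapping.lookup (chain_smult q c) gs = q * Poly_Mapping.lookup c gs"
  by (simp add: chain_smult_def map.rep_eq when_def)

lemma chain_smult_simps:
  "chain_smult q (c + d) = chain_smult q c + chain_smult q d"
  "chain_smult (q + r) c = chain_smult q c + chain_smult r c"
  "chain_smult (q * r) c = chain_smult q (chain_smult r c)"
  "chain_smult 1 c = c" "chain_smult 0 c = 0" "chain_smult q 0 = 0"
  by (auto intro!: poly_mapping_eqI simp: lookup_add algebra_simps)

lemma bar_boundary_superset:
  assumes "finite A" "Poly_Mapping.keys c \<subseteq> A"
  shows "bar_boundary G c =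
    (\<Sum>gs\<in>A. chain_smult (Poly_Mapping.lookup c gs) (bar_d G gs))"
  unfolding bar_boundary_def using assms
  by (intro sum.mono_neutral_left) (auto simp: in_keys_iff chain_smult_simps)

lemma bar_boundary_add: "bar_boundary G (c + d) = bar_boundary G c + bar_boundary G d"
proof -
  let ?A = "Poly_Mapping.keys c \<union> Poly_Mapping.keys d"
  show ?thesis
    using bar_boundary_superset[of ?A c G] bar_boundary_superset[of ?A d G]
      bar_boundary_superset[of ?A "c + d" G] Poly_Mapping.keys_add[of c d]
    by (simp add: lookup_add chain_smult_simps sum.distrib)
qed

lemma bar_boundary_smult: "bar_boundary G (chain_smult q c) = chain_smult q (bar_boundary G c)"
proof -
  have k: "Poly_Mapping.keys (chain_smult q c) \<subseteq> Poly_Mapping.keys c"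
    by (auto simp: in_keys_iff)
  have "chain_smult q (sum f A) = (\<Sum>x\<in>A. chain_smult q (f x))" if "finite A"
    for f :: "'a list \<Rightarrow> 'a chain" and A
    using that by (induction A) (auto simp: chain_smult_simps)
  then show ?thesis
    unfolding bar_boundary_superset[OF finite_keys k]
    by (simp only: bar_boundary_def finite_keys lookup_chain_smult chain_smult_simps)
qed

lemma bar_boundary_0 [simp]: "bar_boundary G 0 = 0"
  by (simp add: bar_boundary_def)

lemma bar_chains_closed:
  "0 \<in> bar_chains G n"
  "c \<in> bar_chains G n \<Longrightarrow> d \<in> bar_chains G n \<Longrightarrow> c + d \<in> bar_chains G n"
  "c \<in> bar_chains G n \<Longrightarrow> chain_smult q c \<in> bar_chains G n"
  using Poly_Mapping.keys_add[of c d]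
  by (auto simp: bar_chains_def in_keys_iff lookup_add)

lemma module_cycle_module: "module rat_field (cycle_module G n)"
proof -
  have minus: "chain_smult (-1) c + c = 0" for c :: "'a chain"
    by (rule poly_mapping_eqI) (simp add: lookup_add)
  have "abelian_group (cycle_module G n)"
  proof (rule abelian_groupI)
    fix c assume "c \<in> carrier (cycle_module G n)"
    then show "\<exists>d\<in>carrier (cycle_module G n). d \<oplus>\<^bsub>cycle_module G n\<^esub> c = \<zero>\<^bsub>cycle_module G n\<^esub>"
      by (intro bexI[of _ "chain_smult (-1) c"])
        (simp_all add: minus cycle_module_def bar_cycles_def bar_chains_closed
          bar_boundary_smult chain_smult_simps)
  qed (auto simp: cycle_module_def bar_cycles_def bar_chains_closed bar_boundary_add add_ac)
  then show ?thesis
    by (intro moduleI fieldE[OF class_field])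
      (auto simp: cycle_module_def bar_cycles_def bar_chains_closed bar_boundary_smult
        chain_smult_simps)
qed

lemma (in Module.module) module_quotient_module:
  assumes sg: "subgroup B (add_monoid M)"
    and B_smult: "\<And>r b. r \<in> carrier R \<Longrightarrow> b \<in> B \<Longrightarrow> r \<odot>\<^bsub>M\<^esub> b \<in> B"
  shows "module R (quotient_module M B)"
proof -
  interpret A: abelian_subgroup B M
    by (intro abelian_subgroupI3 additive_subgroupI sg) (rule abelian_group_axioms)
  have sm: "r \<odot>\<^bsub>quotient_module M B\<^esub> (B +>\<^bsub>M\<^esub> x) = B +>\<^bsub>M\<^esub> (r \<odot>\<^bsub>M\<^esub> x)"
    if r: "r \<in> carrier R" and x: "x \<in> carrier M" for r x
  proof -
    have "(\<lambda>x. r \<odot>\<^bsub>M\<^esub> x) ` (B +>\<^bsub>M\<^esub> x) \<subseteq> B +>\<^bsub>M\<^esub> (r \<odot>\<^bsub>M\<^esub> x)"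
      using r x B_smult A.a_Hcarr
      by (auto simp: a_r_coset_def' smult_r_distr)
    moreover have "r \<odot>\<^bsub>M\<^esub> x \<in> (\<lambda>x. r \<odot>\<^bsub>M\<^esub> x) ` (B +>\<^bsub>M\<^esub> x)"
      using A.a_rcos_self[OF x] by blast
    moreover have "B <+>\<^bsub>M\<^esub> C = B +>\<^bsub>M\<^esub> y"
      if C: "C \<subseteq> B +>\<^bsub>M\<^esub> y" "y \<in> C" "y \<in> carrier M" for C y
    proof
      show "B <+>\<^bsub>M\<^esub> C \<subseteq> B +>\<^bsub>M\<^esub> y"
      proof
        fix z assume "z \<in> B <+>\<^bsub>M\<^esub> C"
        then obtain b c where bc: "b \<in> B" "c \<in> C" "z = b \<oplus>\<^bsub>M\<^esub> c"
          by (auto simp: set_add_def set_mult_def)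
        then obtain b' where b': "b' \<in> B" "c = b' \<oplus>\<^bsub>M\<^esub> y"
          using C by (auto simp: a_r_coset_def')
        have "z = (b \<oplus>\<^bsub>M\<^esub> b') \<oplus>\<^bsub>M\<^esub> y"
          using bc b' C A.a_Hcarr by (simp add: M.a_assoc)
        then show "z \<in> B +>\<^bsub>M\<^esub> y"
          using bc b' A.a_closed by (auto simp: a_r_coset_def')
      qed
      show "B +>\<^bsub>M\<^esub> y \<subseteq> B <+>\<^bsub>M\<^esub> C"
        using C by (auto simp: set_add_def set_mult_def a_r_coset_def')
    qed
    ultimately show ?thesis
      using r x by (simp add: quotient_module_def)
  qed
  have add: "(B +>\<^bsub>M\<^esub> x) \<oplus>\<^bsub>quotient_module M B\<^esub> (B +>\<^bsub>M\<^esub> y) = B +>\<^bsub>M\<^esub> (x \<oplus>\<^bsub>M\<^esub> y)"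
    if "x \<in> carrier M" "y \<in> carrier M" for x y
    using that A.a_rcos_sum by (simp add: quotient_module_def)
  have car: "C \<in> carrier (quotient_module M B) \<longleftrightarrow> (\<exists>x\<in>carrier M. C = B +>\<^bsub>M\<^esub> x)" for C
    by (auto simp: quotient_module_def A_RCOSETS_def')
  interpret Q: comm_group "M A_Mod B"
    by (rule A.a_factorgroup_is_comm_group)
  have Q: "carrier (quotient_module M B) = carrier (M A_Mod B)"
    "add (quotient_module M B) = mult (M A_Mod B)"
    "zero (quotient_module M B) = one (M A_Mod B)"
    by (simp_all add: quotient_module_def A_FactGroup_def FactGroup_def A_RCOSETS_def set_add_def)
  have "abelian_group (quotient_module M B)"
    by (rule abelian_groupI; unfold Q)
      (fact Q.m_closed Q.one_closed Q.m_assoc Q.m_comm Q.l_one Q.l_inv_ex)+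
  then show ?thesis
    by (intro moduleI is_cring)
      (auto simp: car sm add smult_l_distr smult_r_distr smult_assoc1)
qed

lemma bar_boundary_single:
  "bar_boundary G (Poly_Mapping.single gs q) = chain_smult q (bar_d G gs)"
  by (simp add: bar_boundary_superset[of "{gs}"])

lemma bar_boundaries_1_cycles:
  assumes "monoid G"
  shows "bar_boundaries G 1 \<subseteq> bar_cycles G 1"
proof
  interpret monoid G by (rule assms)
  have d1: "bar_boundary G (Poly_Mapping.single [a] q) = 0" for a q
    by (simp add: bar_boundary_single bar_d_def bar_face_def atMost_Suc
        single_add[symmetric] chain_smult_simps)
  have d2: "bar_d G [a, b] =
      Poly_Mapping.single [b] 1 + (Poly_Mapping.single [a \<otimes>\<^bsub>G\<^esub> b] (-1)
        + Poly_Mapping.single [a] 1)" for a b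
    by (simp add: bar_d_def bar_face_def atMost_Suc numeral_2_eq_2 add_ac)
  have single: "Poly_Mapping.single [a] q \<in> bar_cycles G 1" if "a \<in> carrier G" for a q
    using that by (auto simp: bar_cycles_def bar_chains_def d1)
  have closed: "0 \<in> bar_cycles G 1"
    "\<And>c d. c \<in> bar_cycles G 1 \<Longrightarrow> d \<in> bar_cycles G 1 \<Longrightarrow> c + d \<in> bar_cycles G 1"
    "\<And>q c. c \<in> bar_cycles G 1 \<Longrightarrow> chain_smult q c \<in> bar_cycles G 1"
    by (auto simp: bar_cycles_def bar_chains_closed bar_boundary_add bar_boundary_smult
        chain_smult_simps)
  have sum_closed: "sum f S \<in> bar_cycles G 1"
    if "finite S" "\<And>x. x \<in> S \<Longrightarrow> f x \<in> bar_cycles G 1" for f and S :: "'a list set"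
    using that
  proof (induction S rule: finite_induct)
    case (insert x S)
    then show ?case
      using closed(2)[of "f x" "sum f S"] by simp
  qed (use closed in simp)
  fix c assume "c \<in> bar_boundaries G 1"
  then obtain e where e: "e \<in> bar_chains G 2" "c = bar_boundary G e"
    by (auto simp: bar_boundaries_def numeral_2_eq_2)
  show "c \<in> bar_cycles G 1"
    unfolding e(2) bar_boundary_def
  proof (intro sum_closed closed finite_keys)
    fix gs assume "gs \<in> Poly_Mapping.keys e"
    then have "length gs = 2" "set gs \<subseteq> carrier G"
      using e(1) by (auto simp: bar_chains_def)
    then obtain a b where "gs = [a, b]" "a \<in> carrier G" "b \<in> carrier G"
      by (auto simp: numeral_2_eq_2 length_Suc_conv)
    then show "bar_d G gs \<in> bar_cycles G 1"
      unfolding \<open>gs = [a, b]\<close> d2 by (intro closed single) auto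
  qed
qed

theorem vectorspace_rat_homology_1:
  assumes "monoid G"
  shows "vectorspace rat_field (rat_homology 1 G)"
proof -
  interpret M: Module.module rat_field "cycle_module G 1"
    by (rule module_cycle_module)
  have minus: "chain_smult (-1) c + c = 0" for c :: "'a chain"
    by (rule poly_mapping_eqI) (simp add: lookup_add)
  have B: "b \<in> bar_boundaries G 1 \<Longrightarrow> chain_smult q b \<in> bar_boundaries G 1" for q b
    by (auto simp: bar_boundaries_def bar_boundary_smult[symmetric] bar_chains_closed)
  have Badd: "a \<in> bar_boundaries G 1 \<Longrightarrow> b \<in> bar_boundaries G 1
      \<Longrightarrow> a + b \<in> bar_boundaries G 1" for a b
    by (auto simp: bar_boundaries_def bar_boundary_add[symmetric] bar_chains_closed)
  have B0: "0 \<in> bar_boundaries G 1"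
    unfolding bar_boundaries_def by (rule image_eqI[of _ _ 0]) (auto simp: bar_chains_closed)
  have "subgroup (bar_boundaries G 1) (add_monoid (cycle_module G 1))"
  proof (rule group.subgroupI[OF M.a_group])
    fix a assume a: "a \<in> bar_boundaries G 1"
    have "inv\<^bsub>add_monoid (cycle_module G 1)\<^esub> a = chain_smult (-1) a"
      by (rule group.inv_equality[OF M.a_group])
        (use a B[of a "-1"] bar_boundaries_1_cycles[OF assms] minus
          in \<open>auto simp: cycle_module_def\<close>)
    with B[OF a] show "inv\<^bsub>add_monoid (cycle_module G 1)\<^esub> a \<in> bar_boundaries G 1"
      by simp
  qed (use bar_boundaries_1_cycles[OF assms] B0 Badd in \<open>auto simp: cycle_module_def\<close>)
  then have "module rat_field (rat_homology 1 G)"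
    unfolding rat_homology_def
    by (rule M.module_quotient_module) (use B in \<open>simp add: cycle_module_def\<close>)
  then show ?thesis
    by (simp add: vectorspace_def class_field)
qed

end

theory Submission
  imports Defs
begin

text \<open>
  Let \<open>f\<close> be an automorphism that fixes \<open>Y\<close> and induces the identity on \<open>F/N\<close>. It sends a
  conjugate \<open>u y u\<inverse>\<close> to \<open>f(u) y f(u)\<inverse>\<close> with \<open>f(u)\<close> congruent to \<open>u\<close> modulo \<open>N\<close>, so it acts
  trivially on the abelianisation of \<open>N\<close>. Hence \<open>f \<mapsto> [f(x) x\<inverse>]\<close> is a homomorphism from \<open>K'\<close>
  to \<open>N/[N,N]\<close> for each \<open>x \<in> X\<close>, and \<open>N/[N,N]\<close> is the free module on \<open>Y\<close> over the group ring of
  \<open>F/N\<close>. Since \<open>n + l \<ge> 2\<close> there is a letter \<open>t \<in> X \<union> Z\<close> other than \<open>x\<close>. For every \<open>i\<close> the map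
  \<open>x \<mapsto> t\<^sup>i y t\<^sup>-\<^sup>i x\<close>, fixing the other letters, lies in \<open>K'\<close> and is sent to the basis element
  \<open>t\<^sup>i [y]\<close>, so the image has infinite rank.

  The module \<open>N/[N,N]\<close> can be avoided. The \<open>y\<close>-coordinate of a class in it is a Fox derivative
  with respect to \<open>y\<close>, and only the powers of \<open>t\<close> matter, so the coefficients are pushed forward
  along the map from \<open>F\<close> to the infinite cyclic group that counts \<open>t\<close> and kills the other
  letters. This gives integers \<open>fox y t j w\<close>, one for each power \<open>j\<close>, which are computed letter by
  letter. The homomorphism property becomes \<open>fox_K'_mult\<close>. It rests on \<open>fox_change_del_Y\<close>: how much
  \<open>f\<close> changes the Fox derivative of \<open>w\<close> depends only on the class of \<open>w\<close> modulo \<open>N\<close>.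

  The conclusion from these characters \<open>\<phi>\<^sub>j(f) = fox y t j (f x)\<close> needs no linear independence
  argument. For a given \<open>f\<close> only finitely many \<open>\<phi>\<^sub>j(f)\<close> are nonzero, so on any finite set of
  group elements, or of homology classes, some \<open>\<phi>\<^sub>j\<close> vanishes. It then vanishes on everything that
  the set generates, but no \<open>\<phi>\<^sub>j\<close> is zero.
\<close>

section \<open>Characters and the first homology\<close>

definition pairing :: "('g list \<Rightarrow> rat) \<Rightarrow> 'g chain \<Rightarrow> rat" where
  "pairing f c = (\<Sum>gs\<in>Poly_Mapping.keys c. Poly_Mapping.lookup c gs * f gs)"

lemma pairing_superset:
  assumes "finite A" "Poly_Mapping.keys c \<subseteq> A"
  shows "pairing f c = (\<Sum>gs\<in>A. Poly_Mapping.lookup c gs * f gs)"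
  unfolding pairing_def using assms
  by (intro sum.mono_neutral_left) (auto simp: in_keys_iff)

lemma pairing_add: "pairing f (c + d) = pairing f c + pairing f d"
proof -
  let ?A = "Poly_Mapping.keys c \<union> Poly_Mapping.keys d"
  show ?thesis
    using pairing_superset[of ?A c f] pairing_superset[of ?A d f]
      pairing_superset[of ?A "c + d" f] Poly_Mapping.keys_add[of c d]
    by (simp add: lookup_add sum.distrib algebra_simps)
qed

lemma pairing_smult: "pairing f (chain_smult q c) = q * pairing f c"
proof -
  have "Poly_Mapping.keys (chain_smult q c) \<subseteq> Poly_Mapping.keys c"
    by (auto simp: in_keys_iff)
  then show ?thesis
    by (simp add: pairing_superset[of "Poly_Mapping.keys c"] sum_distrib_left mult.assoc)
qed

lemma pairing_single: "pairing f (Poly_Mapping.single gs q) = q * f gs"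
  by (simp add: pairing_superset[of "{gs}"])

lemma pairing_zero: "pairing f 0 = 0"
  by (simp add: pairing_def)

lemma pairing_sum: "finite S \<Longrightarrow> pairing f (sum c S) = (\<Sum>x\<in>S. pairing f (c x))"
  by (induction S rule: finite_induct) (auto simp: pairing_zero pairing_add)

text \<open>
  The boundary of \<open>[g | h]\<close> is \<open>[h] - [gh] + [g]\<close>, so a function on 1-chains that comes from an
  additive character kills boundaries and descends to the first homology.
\<close>

lemma pairing_boundary_eq_0:
  assumes add: "\<And>g h. g \<in> carrier G \<Longrightarrow> h \<in> carrier G \<Longrightarrow> \<phi> (g \<otimes>\<^bsub>G\<^esub> h) = \<phi> g + \<phi> h"
    and b: "b \<in> bar_boundaries G 1"
  shows "pairing (\<lambda>gs. \<phi> (hd gs)) b = 0"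
proof -
  obtain e where e: "e \<in> bar_chains G 2" "b = bar_boundary G e"
    using b by (auto simp: bar_boundaries_def numeral_2_eq_2)
  have "pairing (\<lambda>gs. \<phi> (hd gs)) (bar_d G gs) = 0" if "gs \<in> Poly_Mapping.keys e" for gs
  proof -
    have "length gs = 2" "set gs \<subseteq> carrier G"
      using e(1) that by (auto simp: bar_chains_def)
    then obtain g h where gh: "gs = [g, h]" "g \<in> carrier G" "h \<in> carrier G"
      by (auto simp: numeral_2_eq_2 length_Suc_conv)
    then show ?thesis
      by (simp add: bar_d_def bar_face_def atMost_Suc numeral_2_eq_2 pairing_add pairing_single add)
  qed
  then show ?thesis
    by (simp add: e(2) bar_boundary_def pairing_sum pairing_smult)
qed

text \<open>
  The kernels of the characters \<open>\<phi> j\<close> are proper subgroups, and every finite set lies in one of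
  them.
\<close>

lemma (in group) not_finitely_generated_if_characters:
  fixes \<phi> :: "nat \<Rightarrow> 'a \<Rightarrow> rat"
  assumes add: "\<And>j g h. g \<in> carrier G \<Longrightarrow> h \<in> carrier G \<Longrightarrow> \<phi> j (g \<otimes> h) = \<phi> j g + \<phi> j h"
    and fin: "\<And>g. g \<in> carrier G \<Longrightarrow> \<forall>\<^sub>F j in sequentially. \<phi> j g = 0"
    and nontrivial: "\<And>j. \<exists>g\<in>carrier G. \<phi> j g \<noteq> 0"
  shows "\<not> finitely_generated G"
proof
  assume "finitely_generated G"
  then obtain S where S: "finite S" "S \<subseteq> carrier G" "generate G S = carrier G"
    by (auto simp: finitely_generated_def)
  then have "\<forall>\<^sub>F j in sequentially. \<forall>s\<in>S. \<phi> j s = 0"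
    by (intro eventually_ball_finite) (use fin in auto)
  then obtain j where j: "\<And>s. s \<in> S \<Longrightarrow> \<phi> j s = 0"
    by (auto simp: eventually_sequentially)
  have one: "\<phi> j \<one> = 0"
    using add[of \<one> \<one> j] by simp
  have "\<phi> j g = 0" if "g \<in> generate G S" for g
    using that
  proof (induction rule: generate.induct)
    case (inv h)
    then show ?case
      using add[of "inv h" h j] S(2) j one by (auto simp: subset_iff)
  next
    case (eng g h)
    then show ?case
      using add S by auto
  qed (use one j in auto)
  then show False
    using nontrivial[of j] S(3) by auto
qed

text \<open>
  The same argument with subspaces: every finite set of homology classes lies in the kernel of some
  nonzero functional induced by \<open>\<phi> j\<close>.
\<close>

lemma (in group) rat_homology_1_not_fin_dim_if_characters:
  fixes \<phi> :: "nat \<Rightarrow> 'a \<Rightarrow> rat"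
  assumes add: "\<And>j g h. g \<in> carrier G \<Longrightarrow> h \<in> carrier G \<Longrightarrow> \<phi> j (g \<otimes> h) = \<phi> j g + \<phi> j h"
    and fin: "\<And>g. g \<in> carrier G \<Longrightarrow> \<forall>\<^sub>F j in sequentially. \<phi> j g = 0"
    and nontrivial: "\<And>j. \<exists>g\<in>carrier G. \<phi> j g \<noteq> 0"
  shows "\<not> vectorspace.fin_dim rat_field (rat_homology 1 G)"
proof
  let ?H = "rat_homology 1 G"
  let ?B = "bar_boundaries G 1"
  define ev where "ev j = pairing (\<lambda>gs. \<phi> j (hd gs))" for j
  interpret H: vectorspace rat_field ?H
    by (rule vectorspace_rat_homology_1) (rule is_monoid)
  have ev_B: "ev j b = 0" if "b \<in> ?B" for j b
    unfolding ev_def using add that by (rule pairing_boundary_eq_0)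
  have carrier_H: "C \<in> carrier ?H \<longleftrightarrow> (\<exists>c\<in>bar_cycles G 1. C = (\<lambda>b. b + c) ` ?B)" for C
    by (auto simp: rat_homology_def quotient_module_def A_RCOSETS_def' a_r_coset_def'
        cycle_module_def)
  have add_H: "C \<oplus>\<^bsub>?H\<^esub> D = {c + d | c d. c \<in> C \<and> d \<in> D}" for C D
    by (auto simp: rat_homology_def quotient_module_def set_add_def set_mult_def cycle_module_def)
  have smult_H: "q \<odot>\<^bsub>?H\<^esub> C = {b + chain_smult q c | b c. b \<in> ?B \<and> c \<in> C}" for q C
    by (auto simp: rat_homology_def quotient_module_def set_add_def set_mult_def cycle_module_def)
  have zero_H: "\<zero>\<^bsub>?H\<^esub> = ?B"
    by (simp add: rat_homology_def quotient_module_def)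
  note One_nat_def [simp del]
  \<comment> \<open>the kernel of the functional that \<open>\<phi> j\<close> induces on homology\<close>
  define N where "N j = {C \<in> carrier ?H. \<forall>c\<in>C. ev j c = 0}" for j
  have N: "submodule rat_field (N j) ?H" for j
  proof (rule submodule.intro)
    show "\<zero>\<^bsub>?H\<^esub> \<in> N j"
      using H.M.zero_closed ev_B unfolding N_def zero_H by blast
    show "C \<oplus>\<^bsub>?H\<^esub> D \<in> N j" if "C \<in> N j" "D \<in> N j" for C D
    proof -
      have "C \<oplus>\<^bsub>?H\<^esub> D \<in> carrier ?H"
        using that by (intro H.M.add.m_closed) (auto simp: N_def)
      then show ?thesis
        using that by (auto simp: N_def add_H ev_def pairing_add)
    qed
    show "q \<odot>\<^bsub>?H\<^esub> C \<in> N j" if "q \<in> carrier rat_field" "C \<in> N j" for q C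
    proof -
      have "q \<odot>\<^bsub>?H\<^esub> C \<in> carrier ?H"
        using that by (intro H.smult_closed) (auto simp: N_def)
      then show ?thesis
        using that ev_B by (auto simp: N_def smult_H ev_def pairing_add pairing_smult)
    qed
  qed (auto simp: N_def H.module_axioms)
  assume "H.fin_dim"
  then obtain A where A: "finite A" "A \<subseteq> carrier ?H" "H.span A = carrier ?H"
    by (auto simp: H.fin_dim_def)
  have "\<forall>\<^sub>F j in sequentially. C \<in> N j" if C: "C \<in> carrier ?H" for C
  proof -
    obtain c where c: "c \<in> bar_cycles G 1" "C = (\<lambda>b. b + c) ` ?B"
      using C carrier_H by blast
    have "\<forall>gs\<in>Poly_Mapping.keys c. hd gs \<in> carrier G"
      using c(1) by (auto simp: bar_cycles_def bar_chains_def One_nat_def length_Suc_conv)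
    then have "\<forall>\<^sub>F j in sequentially. \<forall>gs\<in>Poly_Mapping.keys c. \<phi> j (hd gs) = 0"
      by (intro eventually_ball_finite) (use fin in auto)
    then show ?thesis
    proof eventually_elim
      case (elim j)
      then have "ev j c = 0"
        by (simp add: ev_def pairing_def)
      then show ?case
        using C ev_B by (auto simp: N_def c(2) ev_def pairing_add)
    qed
  qed
  then have "\<forall>\<^sub>F j in sequentially. \<forall>C\<in>A. C \<in> N j"
    by (intro eventually_ball_finite) (use A in auto)
  then obtain j where "A \<subseteq> N j"
    by (auto simp: eventually_sequentially)
  then have sub: "carrier ?H \<subseteq> N j"
    using H.span_is_subset[OF _ N] A(3) by blast
  \<comment> \<open>every group element is a 1-cycle, and its value is that of the character\<close>
  obtain g where g: "g \<in> carrier G" "\<phi> j g \<noteq> 0"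
    using nontrivial by blast
  let ?c = "Poly_Mapping.single [g] 1 :: 'a chain"
  have cyc: "?c \<in> bar_cycles G 1"
    using g by (auto simp: bar_cycles_def bar_chains_def bar_boundary_single bar_d_def bar_face_def
        atMost_Suc single_add[symmetric] chain_smult_simps One_nat_def)
  have "0 \<in> ?B"
    unfolding bar_boundaries_def by (rule image_eqI[of _ _ 0]) (auto simp: bar_chains_closed)
  then have "?c \<in> (\<lambda>b. b + ?c) ` ?B"
    by force
  then have "ev j ?c = 0"
    using sub cyc carrier_H by (auto simp: N_def)
  then show False
    using g(2) by (simp add: ev_def pairing_single)
qed


section \<open>Reduction of words and transvections\<close>

abbreviation red :: "('a \<times> bool) list \<Rightarrow> ('a \<times> bool) list" where
  "red w \<equiv> foldr cons_red w []"

abbreviation winv :: "('a \<times> bool) list \<Rightarrow> ('a \<times> bool) list" where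
  "winv w \<equiv> rev (map inv_letter w)"

lemma foldr_red: "reduced v \<Longrightarrow> foldr cons_red (red u) v = foldr cons_red u v"
  using foldr_assoc[of v u "[]"] by simp

lemma winv_winv: "winv (winv w) = w"
  by (simp add: rev_map comp_def)

lemma foldr_winv: "reduced v \<Longrightarrow> foldr cons_red w (foldr cons_red (winv w) v) = v"
  using foldr_inverse[of v "winv w"] by (simp only: winv_winv)

text \<open>
  A transvection is the endomorphism \<open>x \<mapsto> c x\<close> that fixes all other letters.
\<close>

definition transvect_letter ::
    "'a \<Rightarrow> ('a \<times> bool) list \<Rightarrow> 'a \<times> bool \<Rightarrow> ('a \<times> bool) list" where
  "transvect_letter x c p =
     (if p = (x, True) then c @ [p] else if p = (x, False) then p # winv c else [p])"

definition transvection ::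
    "'a \<Rightarrow> ('a \<times> bool) list \<Rightarrow> ('a \<times> bool) list \<Rightarrow> ('a \<times> bool) list" where
  "transvection x c w = red (concat (map (transvect_letter x c) w))"

lemma reduced_transvection: "reduced (transvection x c w)"
  by (simp add: transvection_def reduced_foldr)

lemma transvection_Nil: "transvection x c [] = []"
  by (simp add: transvection_def)

lemma transvection_Cons:
  "transvection x c (p # w) = foldr cons_red (transvect_letter x c p) (transvection x c w)"
  by (simp add: transvection_def)

lemma transvect_letter_inv_letter:
  "transvect_letter x c (inv_letter p) = winv (transvect_letter x c p)"
  by (cases p) (auto simp: transvect_letter_def rev_map comp_def)

lemma transvection_cons_red: "transvection x c (cons_red p w) = transvection x c (p # w)"
proof (cases w)
  case (Cons q w')
  have "foldr cons_red (transvect_letter x c p)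
      (foldr cons_red (winv (transvect_letter x c p)) (transvection x c w')) = transvection x c w'"
    by (intro foldr_winv reduced_transvection)
  then show ?thesis
    by (cases "q = inv_letter p")
      (simp_all add: Cons transvection_Cons transvect_letter_inv_letter del: inv_letter_simps(5))
qed simp

lemma transvection_mult:
  "transvection x c (foldr cons_red u v) = foldr cons_red (transvection x c u) (transvection x c v)"
  by (induction u)
    (simp_all add: transvection_Nil transvection_cons_red transvection_Cons foldr_assoc
      reduced_transvection)

lemma map_transvect_letter_id:
  "x \<notin> fst ` set u \<Longrightarrow> concat (map (transvect_letter x c) u) = u"
  by (induction u) (auto simp: transvect_letter_def)

text \<open>
  The word \<open>c\<close> avoids \<open>x\<close>, so it is fixed by \<open>x \<mapsto> c\<inverse> x\<close>, and \<open>x \<mapsto> c x \<mapsto> c c\<inverse> x = x\<close>.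
\<close>

lemma transvection_inverse:
  assumes x: "x \<notin> fst ` set c" and w: "reduced w"
  shows "transvection x (winv c) (transvection x c w) = w"
proof -
  let ?t = "transvect_letter x c" and ?t' = "transvect_letter x (winv c)"
  have x': "x \<notin> fst ` set (winv c)"
    using x by (auto simp: image_image)
  have letter: "foldr cons_red (transvection x (winv c) (?t p)) v = cons_red p v"
    if v: "reduced v" for p v
  proof -
    have "foldr cons_red (concat (map ?t' (?t p))) v = cons_red p v"
    proof -
      consider "p = (x, True)" | "p = (x, False)" | "fst p \<noteq> x"
        by (cases p) auto
      then show ?thesis
      proof cases
        case 1
        then have "concat (map ?t' (?t p)) = c @ winv c @ [p]"
          using map_transvect_letter_id[OF x, of "winv c"] by (simp add: transvect_letter_def)
        then show ?thesis
          using v by (simp add: foldr_winv reduced_cons_red del: rev_map)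
      next
        case 2
        have "concat (map ?t' (?t p)) = [p] @ winv (winv c) @ winv c"
          using map_transvect_letter_id[OF x', of "winv c"] 2
          by (simp add: transvect_letter_def)
        then show ?thesis
          using v foldr_inverse[of v "winv c"] by simp
      next
        case 3
        then show ?thesis
          by (auto simp: transvect_letter_def)
      qed
    qed
    then show ?thesis
      using v by (simp add: transvection_def foldr_red)
  qed
  have "transvection x (winv c) (transvection x c w) = red w"
    by (induction w)
      (simp_all add: transvection_Nil transvection_Cons transvection_mult letter reduced_foldr)
  then show ?thesis
    using w by (simp add: foldr_Nil)
qed

lemma letters_transvection:
  assumes "x \<in> S" "fst ` set c \<subseteq> S" "fst ` set w \<subseteq> S"
  shows "fst ` set (transvection x c w) \<subseteq> S"
proof -
  have "fst ` set (concat (map (transvect_letter x c) w)) \<subseteq> S"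
    using assms by (auto simp: transvect_letter_def split: if_splits)
  then show ?thesis
    using letters_foldr[of "concat (map (transvect_letter x c) w)" "[]"]
    by (simp add: transvection_def)
qed

lemma transvection_auto:
  assumes x: "x \<in> S" "x \<notin> fst ` set c" and c: "fst ` set c \<subseteq> S"
  shows "restrict (transvection x c) (carrier (free_group S)) \<in> auto (free_group S)"
proof -
  let ?F = "free_group S"
  have x': "x \<notin> fst ` set (winv c)" and c': "fst ` set (winv c) \<subseteq> S"
    using x c by (auto simp: image_image)
  have closed: "transvection x d w \<in> carrier ?F"
    if "w \<in> carrier ?F" "fst ` set d \<subseteq> S" for d w
    using that letters_transvection[OF x(1), of d w]
    by (simp add: free_group_def reduced_transvection)
  have "bij_betw (transvection x c) (carrier ?F) (carrier ?F)"
  proof (rule bij_betw_byWitness[where f' = "transvection x (winv c)"])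
    show "\<forall>w\<in>carrier ?F. transvection x (winv c) (transvection x c w) = w"
      using transvection_inverse[OF x(2)] by (simp add: free_group_def)
    show "\<forall>w\<in>carrier ?F. transvection x c (transvection x (winv c) w) = w"
      using transvection_inverse[OF x'] unfolding winv_winv by (simp add: free_group_def)
  qed (use closed c c' in blast)+
  then have "restrict (transvection x c) (carrier ?F) \<in> Bij (carrier ?F)"
    by (simp add: Bij_def)
  moreover have "restrict (transvection x c) (carrier ?F) \<in> hom ?F ?F"
    using monoid.m_closed[OF group.is_monoid[OF group_free_group[of S]]]
    by (auto simp: hom_def closed c) (simp add: free_group_def transvection_mult)
  ultimately show ?thesis
    by (simp add: auto_def)
qed

lemma del_Y_append: "del_Y k (u @ v) = foldr cons_red (del_Y k u) (del_Y k v)"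
  by (simp add: del_Y_def foldr_red reduced_foldr)

lemma del_Y_Cons: "del_Y k (p # w) = foldr cons_red (del_Y k [p]) (del_Y k w)"
  using del_Y_append[of k "[p]" w] by simp

lemma del_Y_winv:
  assumes "del_Y k c = []"
  shows "del_Y k (winv c) = []"
proof -
  have "filter (\<lambda>p. fst p \<notin> Ys k) (winv c) = winv (filter (\<lambda>p. fst p \<notin> Ys k) c)"
    by (induction c) auto
  then show ?thesis
    using assms foldr_inverse[of "[]" "filter (\<lambda>p. fst p \<notin> Ys k) c"]
    by (simp add: del_Y_def)
qed

lemma del_Y_transvection:
  assumes "del_Y k c = []"
  shows "del_Y k (transvection x c w) = del_Y k w"
proof (induction w)
  case (Cons p w)
  have "del_Y k (transvect_letter x c p) = del_Y k [p]"
    using assms del_Y_winv[OF assms]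
    by (auto simp: transvect_letter_def del_Y_append del_Y_Cons[of k _ "winv c"] 
        foldr_Nil[OF reduced_del_Y])
  then show ?case
    using Cons del_Y_Cons[of k p w] by (simp add: transvection_Cons del_Y_mult)
qed (simp add: transvection_Nil)


section \<open>A Fox derivative\<close>

fun letter_exp :: "'a \<Rightarrow> 'a \<times> bool \<Rightarrow> int" where
  "letter_exp t (a, e) = (if a = t then (if e then 1 else -1) else 0)"

definition exponent :: "'a \<Rightarrow> ('a \<times> bool) list \<Rightarrow> int" where
  "exponent t w = sum_list (map (letter_exp t) w)"

text \<open>
  The number \<open>fox y t j w\<close> is the coefficient at \<open>t\<^sup>j\<close> of the image of the Fox derivative
  \<open>\<partial>w/\<partial>y\<close> under the ring homomorphism from the group ring of the free group to the Laurent
  polynomials in \<open>t\<close> that sends all letters other than \<open>t\<close> to \<open>1\<close>. Here \<open>y \<noteq> t\<close> is intended: since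
  \<open>y\<close> goes to \<open>1\<close>, the letter \<open>y\<inverse>\<close>, whose derivative is \<open>-y\<inverse>\<close>, contributes \<open>-1\<close>. The word may
  be unreduced, and reduction preserves the value.
\<close>

fun fox :: "'a \<Rightarrow> 'a \<Rightarrow> int \<Rightarrow> ('a \<times> bool) list \<Rightarrow> int" where
  "fox y t j [] = 0"
| "fox y t j (p # w) = (if j = 0 then letter_exp y p else 0) + fox y t (j - letter_exp t p) w"

lemma letter_exp_inv_letter: "letter_exp t (inv_letter p) = - letter_exp t p"
  by (cases p) auto

lemma letter_exp_0: "fst p \<noteq> t \<Longrightarrow> letter_exp t p = 0"
  by (cases p) auto

lemma exponent_cons_red: "exponent t (cons_red p w) = exponent t (p # w)"
  by (cases w) (auto simp: exponent_def letter_exp_inv_letter)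

lemma exponent_mult: "exponent t (foldr cons_red u v) = exponent t u + exponent t v"
  by (induction u) (auto simp: exponent_cons_red, auto simp: exponent_def)

lemma exponent_del_Y:
  assumes "t \<notin> Ys k"
  shows "exponent t (del_Y k w) = exponent t w"
proof (induction w)
  case (Cons p w)
  have "exponent t (del_Y k [p]) = exponent t [p]"
    using assms letter_exp_0[of p t] by (auto simp: del_Y_def exponent_def)
  then show ?case
    using Cons del_Y_Cons[of k p w] by (simp add: exponent_mult) (simp add: exponent_def)
qed (simp add: del_Y_def)

lemma fox_append: "fox y t j (u @ v) = fox y t j u + fox y t (j - exponent t u) v"
  by (induction u arbitrary: j) (auto simp: exponent_def algebra_simps)

lemma fox_cons_red:
  assumes "y \<noteq> t"
  shows "fox y t j (cons_red p w) = fox y t j (p # w)"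
  using assms by (cases w; cases p) (auto simp: letter_exp_inv_letter)

text \<open>
  This is the product rule \<open>\<partial>(uv) = \<partial>u + u \<partial>v\<close>: multiplication by the image of \<open>u\<close>, a power of
  \<open>t\<close>, shifts the coefficients.
\<close>

lemma fox_mult:
  assumes "y \<noteq> t"
  shows "fox y t j (foldr cons_red u v) = fox y t j u + fox y t (j - exponent t u) v"
  by (induction u arbitrary: j)
    (auto simp: fox_cons_red[OF assms] exponent_def algebra_simps)

text \<open>
  The part of \<open>w\<close> before an occurrence of \<open>y\<close> is shorter than \<open>w\<close>, and each of its letters
  changes the exponent of \<open>t\<close> by at most one. So only finitely many coefficients are nonzero.
\<close>

lemma fox_eq_0_if_long: "int (length w) \<le> \<bar>j\<bar> \<Longrightarrow> fox y t j w = 0"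
proof (induction w arbitrary: j)
  case (Cons p w)
  have "\<bar>letter_exp t p\<bar> \<le> 1"
    by (cases p) auto
  then show ?case
    using Cons by auto
qed simp

lemma fox_replicate: "y \<noteq> t \<Longrightarrow> fox y t j (replicate i (t, b)) = 0"
  by (induction i arbitrary: j) auto

lemma exponent_replicate: "exponent t (replicate i (t, b)) = (if b then int i else - int i)"
  by (induction i) (auto simp: exponent_def)


section \<open>Automorphisms trivial modulo the normal closure of \<open>Y\<close>\<close>

lemma ident_eq_iff:
  assumes "u \<in> carrier (F n k l)" "v \<in> carrier (F n k l)"
  shows "ident n k l u = ident n k l v \<longleftrightarrow> del_Y k u = del_Y k v"
proof -
  have "inj_on (ident n k l) (carrier (F n 0 l))"
    using ident_iso by (auto simp: iso_def bij_betw_def)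
  then show ?thesis
    using assms del_Y_closed ident_del_Y by (metis inj_onD)
qed

text \<open>
  Equality, and not only \<open>f(N) \<subseteq> N\<close>, is what makes the image of a coset of \<open>N\<close> a coset again, so
  that the inverse of \<^const>\<open>ident\<close> in the definition of \<^const>\<open>rho'\<close> is applied within the range
  of \<^const>\<open>ident\<close>. Both inclusions follow from minimality of \<open>N\<close>: the image and the preimage of
  \<open>N\<close> are normal and contain \<open>Y\<close>.
\<close>

lemma auto_image_NY:
  assumes f: "f \<in> auto (F n k l)" and fY: "\<And>v. v \<in> Ys k \<Longrightarrow> f (gen v) = gen v"
  shows "f ` NY n k l = NY n k l"
proof -
  let ?F = "F n k l" and ?N = "NY n k l"
  interpret group_hom ?F ?F f
    using f by (simp add: group_hom_def group_hom_axioms_def group_F auto_def)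
  interpret N: normal ?N ?F
    by (rule NY_normal)
  have surj: "f ` carrier ?F = carrier ?F"
    using f by (auto simp: auto_def Bij_def bij_betw_def)
  have minimal: "?N \<subseteq> M" if "M \<lhd> ?F" "gen ` Ys k \<subseteq> M" for M
    using that by (auto simp: NY_def normal_closure_def)
  have "f ` ?N \<lhd> ?F"
  proof (rule normal_invI)
    show "subgroup (f ` ?N) ?F"
      by (rule subgroup_img_is_subgroup) (rule N.subgroup_axioms)
    fix x h assume x: "x \<in> carrier ?F" and "h \<in> f ` ?N"
    then obtain x' h' where *: "x' \<in> carrier ?F" "x = f x'" "h' \<in> ?N" "h = f h'"
      using surj by blast
    then have "x \<otimes>\<^bsub>?F\<^esub> h \<otimes>\<^bsub>?F\<^esub> inv\<^bsub>?F\<^esub> x = f (x' \<otimes>\<^bsub>?F\<^esub> h' \<otimes>\<^bsub>?F\<^esub> inv\<^bsub>?F\<^esub> x')"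
      by simp
    then show "x \<otimes>\<^bsub>?F\<^esub> h \<otimes>\<^bsub>?F\<^esub> inv\<^bsub>?F\<^esub> x \<in> f ` ?N"
      using * N.inv_op_closed2 by blast
  qed
  moreover have "gen ` Ys k \<subseteq> f ` ?N"
    using gen_Ys_NY[of k n l] fY by (metis (no_types, lifting) image_subset_iff image_eqI)
  moreover have "{w \<in> carrier ?F. f w \<in> ?N} \<lhd> ?F"
  proof (rule normal_invI)
    show "subgroup {w \<in> carrier ?F. f w \<in> ?N} ?F"
      by (rule subgroupI) auto
    show "x \<otimes>\<^bsub>?F\<^esub> h \<otimes>\<^bsub>?F\<^esub> inv\<^bsub>?F\<^esub> x \<in> {w \<in> carrier ?F. f w \<in> ?N}"
      if "x \<in> carrier ?F" "h \<in> {w \<in> carrier ?F. f w \<in> ?N}" for x h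
      using that N.inv_op_closed2 by auto
  qed
  moreover have "gen ` Ys k \<subseteq> {w \<in> carrier ?F. f w \<in> ?N}"
    using gen_Ys_NY[of k n l] gen_Ys_closed[of k n l] fY by auto
  ultimately show ?thesis
    using minimal by blast
qed

lemma auto_image_ident:
  assumes f: "f \<in> auto (F n k l)" and fY: "\<And>v. v \<in> Ys k \<Longrightarrow> f (gen v) = gen v"
    and w: "w \<in> carrier (F n k l)"
  shows "f ` ident n k l w = ident n k l (f w)"
proof -
  interpret N: normal "NY n k l" "F n k l"
    by (rule NY_normal)
  have "f \<in> hom (F n k l) (F n k l)"
    using f by (simp add: auto_def)
  then have "f ` ident n k l w = (\<lambda>m. m \<otimes>\<^bsub>F n k l\<^esub> f w) ` (f ` NY n k l)"
    using w N.mem_carrier by (auto simp: ident_def r_coset_def image_iff hom_mult)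
  then show ?thesis
    by (auto simp: auto_image_NY[OF f fY] ident_def r_coset_def)
qed

text \<open>
  Cosets of \<open>N\<close> are represented by the words in \<open>X \<union> Z\<close>, and \<^term>\<open>del_Y k\<close> computes the
  representative. This turns the kernel of \<^const>\<open>rho'\<close> into a condition on words.
\<close>

lemma carrier_K':
  "f \<in> carrier (K' n k l) \<longleftrightarrow>
     f \<in> auto (F n k l) \<and> (\<forall>v\<in>Ys k \<union> Zs l. f (gen v) = gen v) \<and>
     (\<forall>w\<in>carrier (F n k l). del_Y k (f w) = del_Y k w)"
proof (cases "f \<in> auto (F n k l) \<and> (\<forall>v\<in>Ys k \<union> Zs l. f (gen v) = gen v)")
  case True
  then have f: "f \<in> auto (F n k l)" and fY: "\<And>v. v \<in> Ys k \<Longrightarrow> f (gen v) = gen v"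
    by auto
  let ?i = "inv_into (carrier (F n 0 l)) (ident n k l)"
  have sub: "carrier (F n 0 l) \<subseteq> carrier (F n k l)"
    by (auto simp: carrier_F subset_iff)
  have fF: "f w \<in> carrier (F n k l)" if "w \<in> carrier (F n k l)" for w
    using f that by (auto simp: auto_def hom_def)
  have rho: "?i (f ` ident n k l w) = del_Y k (f w)" if w: "w \<in> carrier (F n 0 l)" for w
  proof -
    have fw: "f w \<in> carrier (F n k l)"
      using fF sub w by blast
    have "f ` ident n k l w = ident n k l (f w)"
      using auto_image_ident[OF f fY] w sub by blast
    also have "\<dots> = ident n k l (del_Y k (f w))"
      by (rule ident_del_Y[OF fw])
    finally show ?thesis
      using ident_iso[of n k l] del_Y_closed[OF fw]
      by (simp add: iso_def bij_betw_def inv_into_f_f)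
  qed
  have "f \<in> carrier (K' n k l) \<longleftrightarrow> rho' n k l f = (\<lambda>w\<in>carrier (F n 0 l). w)"
    using True by (simp add: K'_def kernel_def A'_def AutoGroup_def BijGroup_def)
  also have "\<dots> \<longleftrightarrow> (\<forall>w\<in>carrier (F n 0 l). del_Y k (f w) = w)"
    using rho by (auto simp: rho'_def fun_eq_iff restrict_def)
  also have "\<dots> \<longleftrightarrow> (\<forall>w\<in>carrier (F n k l). del_Y k (f w) = del_Y k w)"
  proof
    assume *: "\<forall>w\<in>carrier (F n 0 l). del_Y k (f w) = w"
    show "\<forall>w\<in>carrier (F n k l). del_Y k (f w) = del_Y k w"
    proof
      fix w assume w: "w \<in> carrier (F n k l)"
      have dw: "del_Y k w \<in> carrier (F n 0 l)"
        by (rule del_Y_closed[OF w])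
      have "ident n k l (f w) = f ` ident n k l (del_Y k w)"
        using auto_image_ident[OF f fY w] ident_del_Y[OF w] by simp
      also have "\<dots> = ident n k l (f (del_Y k w))"
        using auto_image_ident[OF f fY] dw sub by blast
      finally have "del_Y k (f w) = del_Y k (f (del_Y k w))"
        using ident_eq_iff fF w dw sub by (meson subsetD)
      then show "del_Y k (f w) = del_Y k w"
        using * dw by simp
    qed
  qed (use sub del_Y_id in force)
  finally show ?thesis
    using True by simp
next
  case False
  then show ?thesis
    by (auto simp: K'_def kernel_def A'_def)
qed

lemma mult_K':
  assumes "f \<in> carrier (K' n k l)" "g \<in> carrier (K' n k l)"
  shows "f \<otimes>\<^bsub>K' n k l\<^esub> g = compose (carrier (F n k l)) f g"
  using assms by (simp add: carrier_K' auto_def)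
    (simp add: K'_def A'_def AutoGroup_def BijGroup_def)

lemma group_K': "group (K' n k l)"
proof -
  let ?F = "F n k l" and ?A = "AutoGroup (F n k l)"
  interpret F: group ?F
    by (rule group_F)
  interpret A: group ?A
    by (rule F.AutoGroup)
  have A: "carrier ?A = auto ?F"
    by (simp add: AutoGroup_def)
  have one: "\<one>\<^bsub>?A\<^esub> = (\<lambda>w\<in>carrier ?F. w)"
    by (simp add: AutoGroup_def BijGroup_def)
  have app: "(f \<otimes>\<^bsub>?A\<^esub> g) w = f (g w)"
    if "f \<in> auto ?F" "g \<in> auto ?F" "w \<in> carrier ?F" for f g w
    using that by (simp add: AutoGroup_def BijGroup_def auto_def compose_def)
  have closed: "f w \<in> carrier ?F" if "f \<in> auto ?F" "w \<in> carrier ?F" for f w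
    using that by (auto simp: auto_def hom_def)
  have gen: "gen v \<in> carrier ?F" if "v \<in> Ys k \<union> Zs l" for v
    using that by (auto simp: carrier_F gen_def reduced_Cons)
  have "subgroup (carrier (K' n k l)) ?A"
  proof (rule A.subgroupI)
    show "carrier (K' n k l) \<subseteq> carrier ?A"
      by (auto simp: carrier_K' A)
    have "\<one>\<^bsub>?A\<^esub> \<in> carrier (K' n k l)"
      using A.one_closed gen by (simp add: carrier_K' A) (simp add: one)
    then show "carrier (K' n k l) \<noteq> {}"
      by blast
    show "f \<otimes>\<^bsub>?A\<^esub> g \<in> carrier (K' n k l)"
      if "f \<in> carrier (K' n k l)" "g \<in> carrier (K' n k l)" for f g
      using that A.m_closed[of f g] by (simp add: carrier_K' A app gen closed)
    fix f assume f: "f \<in> carrier (K' n k l)"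
    let ?g = "inv\<^bsub>?A\<^esub> f"
    have fA: "f \<in> auto ?F" and gA: "?g \<in> auto ?F"
      using f A.inv_closed[of f] by (auto simp: carrier_K' A)
    have gf: "?g (f w) = w" and fg: "f (?g w) = w" if "w \<in> carrier ?F" for w
      using app[OF gA fA that] app[OF fA gA that] A.l_inv[of f] A.r_inv[of f] fA that
      by (simp_all add: A one)
    have "?g (gen v) = gen v" if "v \<in> Ys k \<union> Zs l" for v
      using gf[OF gen[OF that]] f that by (auto simp: carrier_K')
    moreover have "del_Y k (?g w) = del_Y k w" if "w \<in> carrier ?F" for w
      using fg[OF that] closed[OF gA that] f by (metis carrier_K')
    ultimately show "?g \<in> carrier (K' n k l)"
      using gA by (simp add: carrier_K')
  qed
  then have "group (?A\<lparr>carrier := carrier (K' n k l)\<rparr>)"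
    by (rule A.subgroup_imp_group)
  moreover have "?A\<lparr>carrier := carrier (K' n k l)\<rparr> = K' n k l"
    by (simp add: K'_def A'_def)
  ultimately show ?thesis
    by simp
qed

text \<open>
  Because \<open>f\<close> preserves exponents of \<open>t\<close>, the difference \<open>\<delta>(w) = \<partial>(f w) - \<partial>w\<close> again satisfies
  the product rule \<open>\<delta>(uv) = \<delta>(u) + u \<delta>(v)\<close>. It vanishes on \<open>Y\<close>, which \<open>f\<close> fixes, and the letters
  of \<open>Y\<close> act trivially on the coefficients, so deleting them from a word does not change \<open>\<delta>\<close>.
\<close>

lemma fox_change_del_Y:
  assumes f: "f \<in> carrier (K' n k l)" and t: "t \<notin> Ys k" "y \<noteq> t"
    and w: "w \<in> carrier (F n k l)"
  shows "fox y t j (f w) - fox y t j w = fox y t j (f (del_Y k w)) - fox y t j (del_Y k w)"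
proof -
  let ?F = "F n k l"
  interpret group_hom ?F ?F f
    using f by (simp add: group_hom_def group_hom_axioms_def group_F carrier_K' auto_def)
  define \<delta> where "\<delta> j w = fox y t j (f w) - fox y t j w" for j w
  have exp_f: "exponent t (f w) = exponent t w" if "w \<in> carrier ?F" for w
    using f that exponent_del_Y[OF t(1)] by (metis carrier_K')
  have \<delta>_mult: "\<delta> j (foldr cons_red u v) = \<delta> j u + \<delta> (j - exponent t u) v"
    if "u \<in> carrier ?F" "v \<in> carrier ?F" for j u v
    using hom_mult[OF that] that by (simp add: mult_F \<delta>_def fox_mult[OF t(2)] exp_f)
  have fY: "f [p] = [p]" if p: "fst p \<in> Ys k" for p
  proof -
    have g: "gen (fst p) \<in> carrier ?F" "f (gen (fst p)) = gen (fst p)"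
      using f p by (auto simp: carrier_K' carrier_F gen_def reduced_Cons)
    show ?thesis
    proof (cases "snd p")
      case True
      then show ?thesis
        using g by (cases p) (simp add: gen_def)
    next
      case False
      have "inv\<^bsub>?F\<^esub> (gen (fst p)) = [p]"
        by (rule G.inv_equality)
          (use p False g in \<open>cases p; auto simp: mult_F one_F carrier_F gen_def reduced_Cons\<close>)+
      then show ?thesis
        using hom_inv[OF g(1)] g(2) by simp
    qed
  qed
  have "\<delta> j w = \<delta> j (del_Y k w)"
    using w
  proof (induction w arbitrary: j)
    case (Cons p w)
    have p: "[p] \<in> carrier ?F" and w: "w \<in> carrier ?F"
      using Cons.prems by (auto simp: carrier_F reduced_Cons)
    have dw: "del_Y k w \<in> carrier ?F"
      using del_Y_closed[OF w] by (auto simp: carrier_F)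
    have "p # w = foldr cons_red [p] w"
      using Cons.prems by (simp add: carrier_F cons_red_reduced)
    then have split: "\<delta> j (p # w) = \<delta> j [p] + \<delta> (j - exponent t [p]) (del_Y k w)"
      using \<delta>_mult[OF p w] Cons.IH[OF w] by simp
    show ?case
    proof (cases "fst p \<in> Ys k")
      case True
      then have "exponent t [p] = 0"
        using t(1) letter_exp_0[of p t] by (auto simp: exponent_def)
      then show ?thesis
        using split True by (simp add: \<delta>_def fY del_Y_def)
    next
      case False
      then have "del_Y k (p # w) = foldr cons_red [p] (del_Y k w)"
        by (simp add: del_Y_def)
      then show ?thesis
        using split \<delta>_mult[OF p dw] by simp
    qed
  qed (simp add: del_Y_def)
  then show ?thesis
    by (simp add: \<delta>_def)
qed

text \<open>
  The words \<open>g(x)\<close> and \<open>x\<close> agree modulo \<open>N\<close>, so \<open>f\<close> changes their Fox derivatives by the same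
  amount, and the derivative of \<open>x\<close> itself is zero.
\<close>

lemma fox_K'_mult:
  assumes f: "f \<in> carrier (K' n k l)" and g: "g \<in> carrier (K' n k l)"
    and x: "x \<in> Xs n" "y \<noteq> x" and t: "t \<notin> Ys k" "y \<noteq> t"
  shows "fox y t j ((f \<otimes>\<^bsub>K' n k l\<^esub> g) (gen x))
    = fox y t j (f (gen x)) + fox y t j (g (gen x))"
proof -
  let ?F = "F n k l"
  have gx: "gen x \<in> carrier ?F" and g0: "fox y t j (gen x) = 0"
    using x by (auto simp: carrier_F gen_def reduced_Cons)
  have ggx: "g (gen x) \<in> carrier ?F"
    using g gx by (auto simp: carrier_K' auto_def hom_def)
  have "del_Y k (g (gen x)) = del_Y k (gen x)"
    using g gx by (simp add: carrier_K')
  then have "fox y t j (f (g (gen x))) - fox y t j (g (gen x))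
      = fox y t j (f (gen x)) - fox y t j (gen x)"
    using fox_change_del_Y[OF f t ggx, of j] fox_change_del_Y[OF f t gx, of j] by metis
  then show ?thesis
    using gx g0 by (simp add: mult_K'[OF f g] compose_def)
qed

lemma transvection_K':
  assumes x: "x \<in> Xs n" and xc: "x \<notin> fst ` set c"
    and c: "fst ` set c \<subseteq> Xs n \<union> Ys k \<union> Zs l" and del: "del_Y k c = []"
  shows "restrict (transvection x c) (carrier (F n k l)) \<in> carrier (K' n k l)"
proof -
  have "restrict (transvection x c) (carrier (F n k l)) \<in> auto (F n k l)"
    unfolding F_def by (rule transvection_auto) (use assms in auto)
  moreover have "transvection x c (gen v) = gen v" "gen v \<in> carrier (F n k l)"
    if "v \<in> Ys k \<union> Zs l" for v
    using that x
    by (auto simp: transvection_def transvect_letter_def gen_def carrier_F reduced_Cons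
        Xs_def Ys_def Zs_def)
  ultimately show ?thesis
    by (simp add: carrier_K' del_Y_transvection[OF del])
qed

text \<open>
  The witness is the transvection \<open>x \<mapsto> t\<^sup>i y t\<^sup>-\<^sup>i x\<close>, in which the only occurrence of \<open>y\<close> is preceded
  by \<open>t\<^sup>i\<close>.
\<close>

lemma ex_K'_fox_eq_1:
  assumes x: "x \<in> Xs n" and y: "y \<in> Ys k" and t: "t \<in> Xs n \<union> Zs l" "t \<noteq> x"
  shows "\<exists>f\<in>carrier (K' n k l). fox y t (int i) (f (gen x)) = 1"
proof -
  let ?u = "replicate i (t, True)"
  let ?c = "?u @ (y, True) # winv ?u"
  let ?f = "restrict (transvection x ?c) (carrier (F n k l))"
  have t_Y: "t \<notin> Ys k" and yx: "y \<noteq> x" and yt: "y \<noteq> t"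
    using x y t by (auto simp: Xs_def Ys_def Zs_def)
  have "filter (\<lambda>p. fst p \<notin> Ys k) ?c = ?u @ winv ?u"
    using t_Y y by simp
  then have del: "del_Y k ?c = []"
    using foldr_winv[of "[]" ?u] by (simp add: del_Y_def)
  have f: "?f \<in> carrier (K' n k l)"
    by (rule transvection_K'[OF x _ _ del]) (use x y t yx in \<open>auto split: if_splits\<close>)
  have "?f (gen x) = red (?c @ [(x, True)])"
    using x by (simp add: carrier_F gen_def reduced_Cons transvection_def transvect_letter_def)
  then have "fox y t (int i) (?f (gen x)) = fox y t (int i) (?c @ [(x, True)])"
    by (simp only: fox_mult[OF yt] fox.simps add_0_right)
  also have "\<dots> = 1"
    using yt yx by (simp add: fox_append fox_replicate exponent_replicate)
  finally show ?thesis
    using f by blast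
qed

theorem theorem5:
  fixes n k l :: nat
  assumes "n \<ge> 1" and "k \<ge> 1" and "n + l \<ge> 2"
  shows "\<not> finitely_generated (K' n k l)
    \<and> \<not> vectorspace.fin_dim rat_field (rat_homology 1 (K' n k l))"
proof -
  \<comment> \<open>\<open>n + l \<ge> 2\<close> provides \<open>t\<close>, which has to differ from \<open>x\<close>: \<open>Zv 1\<close> exists if \<open>n = 1\<close>\<close>
  define x y t where "x = Xv 1" and "y = Yv 1" and "t = (if n \<ge> 2 then Xv 2 else Zv 1)"
  have x: "x \<in> Xs n" and y: "y \<in> Ys k" and t: "t \<in> Xs n \<union> Zs l" "t \<noteq> x"
    using assms by (auto simp: x_def y_def t_def Xs_def Ys_def Zs_def)
  have t_Y: "t \<notin> Ys k" and yx: "y \<noteq> x" and yt: "y \<noteq> t"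
    using x y t by (auto simp: Xs_def Ys_def Zs_def)
  interpret K: group "K' n k l"
    by (rule group_K')
  define \<phi> where "\<phi> j f = rat_of_int (fox y t (int j) (f (gen x)))" for j and f :: "word \<Rightarrow> word"
  have add: "\<phi> j (f \<otimes>\<^bsub>K' n k l\<^esub> g) = \<phi> j f + \<phi> j g"
    if "f \<in> carrier (K' n k l)" "g \<in> carrier (K' n k l)" for j f g
    using fox_K'_mult[OF that x yx t_Y yt] by (simp add: \<phi>_def)
  have fin: "\<forall>\<^sub>F j in sequentially. \<phi> j f = 0" for f
    unfolding eventually_sequentially \<phi>_def
    by (rule exI[of _ "length (f (gen x))"]) (simp add: fox_eq_0_if_long)
  have nontrivial: "\<exists>f\<in>carrier (K' n k l). \<phi> j f \<noteq> 0" for j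
    using ex_K'_fox_eq_1[OF x y t, of j] by (force simp: \<phi>_def)
  show ?thesis
    using K.not_finitely_generated_if_characters[of \<phi>, OF add fin nontrivial]
      K.rat_homology_1_not_fin_dim_if_characters[of \<phi>, OF add fin nontrivial]
    by blast
qed

end
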